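(* Let $(\Omega,\mu)$ be a probability space, $p\in\mathbb R$, and let $f$ be a measurable function on $\Omega$ with $0<\langle|f|^p\rangle<\infty$ and $|f|^p\ln|f|$ integrable. Let $U_0>0$ and $0<c<1$, and let $$A=\{|f|\ge U_0^{1-c}s_p^{c}\}.$$ Then $$(1-c)\Big\langle|f|^p\ln_+\frac{|f|}{U_0}\Big\rangle\le\Big\langle|f|^p\ln_+\frac{|f|}{U_0}\,\chi_A\Big\rangle.$$
   Context: $\langle g\rangle=\int_\Omega g\,d\mu$; $\chi_A$ is the indicator function of $A$; $\ln_+x=\max\{\ln x,0\}$ (with $\ln_+0=0$); $|f|^p\ln|f|$ is taken to be $0$ where $f=0$ (for $p\le 0$, $f\neq0$ almost everywhere is assumed). The active threshold is $$s_p=\exp\Big\{\frac{\langle|f|^p\ln|f|\rangle}{\langle|f|^p\rangle}\Big\}.$$ *)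

theory Defs
  imports "HOL-Probability.Probability"
begin

text \<open>
  The value field is any real normed field, so that real- and complex-valued functions are
  both covered; \<open>norm\<close> is the modulus.  The conventions \<open>0 powr p = 0\<close> and
  \<open>ln 0 = 0\<close> of the library make \<open>norm (f x) powr p * ln (norm (f x))\<close> vanish where
  \<open>f\<close> does.  Note that \<open>0 powr p = 0\<close> also for \<open>p \<le> 0\<close>, which is harmless only
  when \<open>f\<close> is nonzero almost everywhere.
\<close>

definition active_threshold ::
    "'a measure \<Rightarrow> real \<Rightarrow> ('a \<Rightarrow> 'b::real_normed_field) \<Rightarrow> real" where
  "active_threshold M p f =
     exp ((\<integral>x. norm (f x) powr p * ln (norm (f x)) \<partial>M) / (\<integral>x. norm (f x) powr p \<partial>M))"

definition ln_plus :: "real \<Rightarrow> real" where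
  "ln_plus x = (if x = 0 then 0 else max (ln x) 0)"

end

theory Submission
  imports Defs
begin

text \<open>
  Put \<open>w = |f|\<^sup>p\<close> and \<open>L = ln (|f| / U\<^sub>0)\<close>. The active threshold is defined
  so that \<open>m = ln (s\<^sub>p / U\<^sub>0)\<close> is the mean of \<open>L\<close> with respect to the weight
  \<open>w\<close>, and, where \<open>f\<close> does not vanish, the condition defining \<open>A\<close> is
  \<open>L \<ge> c m\<close>. The assertion is therefore that the region where \<open>L\<close> is less than \<open>c\<close>
  times its mean carries at most the fraction \<open>c\<close> of the weighted integral of the positive part
  \<open>L\<^sub>+\<close>. On that region \<open>L\<^sub>+ \<le> c m\<^sub>+\<close>, and the integral of \<open>w m\<^sub>+\<close> is the
  positive part of the integral of \<open>w L\<close>, which is at most the integral of \<open>w L\<^sub>+\<close>.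
  This is \<open>positive_part_above_fraction_of_mean\<close>.
\<close>

text \<open>
  The set \<open>A\<close> only has to contain the points of positive weight where \<open>L > c m\<close>: this
  leaves room for points where \<open>w\<close> vanishes and \<open>L\<close> takes a meaningless default value,
  such as \<open>ln 0\<close>.
\<close>

lemma positive_part_above_fraction_of_mean:
  fixes M :: "'a measure" and w L :: "'a \<Rightarrow> real" and c m :: real
  assumes w: "integrable M w" and w_nonneg: "\<And>x. 0 \<le> w x"
    and wL: "integrable M (\<lambda>x. w x * L x)"
    and mean: "(\<integral>x. w x * L x \<partial>M) = m * (\<integral>x. w x \<partial>M)"
    and c: "0 \<le> c" and A: "A \<in> sets M"
    and below: "\<And>x. x \<in> space M \<Longrightarrow> x \<notin> A \<Longrightarrow> w x \<noteq> 0 \<Longrightarrow> L x \<le> c * m"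
  shows "(1 - c) * (\<integral>x. w x * max (L x) 0 \<partial>M)
       \<le> (\<integral>x. w x * max (L x) 0 * indicator A x \<partial>M)"
proof -
  define P where "P x = w x * max (L x) 0" for x
  have P_eq: "P = (\<lambda>x. max (w x * L x) 0)"
    using w_nonneg by (auto simp: P_def max_mult_distrib_left)
  have P: "integrable M P"
    unfolding P_eq using wL by simp
  have PA: "integrable M (\<lambda>x. P x * indicator A x)"
    using integrable_mult_indicator[OF A P] by (simp add: mult.commute)
  have "(\<integral>x. P x \<partial>M) - (\<integral>x. P x * indicator A x \<partial>M)
      = (\<integral>x. P x - P x * indicator A x \<partial>M)"
    using P PA by simp
  also have "\<dots> \<le> (\<integral>x. c * max m 0 * w x \<partial>M)"
  proof (rule integral_mono)
    fix x assume x: "x \<in> space M"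
    show "P x - P x * indicator A x \<le> c * max m 0 * w x"
    proof (cases "x \<in> A \<or> w x = 0")
      case True
      then show ?thesis
        using c w_nonneg[of x] by (auto simp: P_def)
    next
      case False
      then have "L x \<le> c * m"
        using below x by blast
      then have "max (L x) 0 \<le> c * max m 0"
        using c by (simp add: max_mult_distrib_left)
      then have "w x * max (L x) 0 \<le> w x * (c * max m 0)"
        using w_nonneg by (rule mult_left_mono)
      then show ?thesis
        using False by (simp add: P_def mult_ac)
    qed
  qed (use P PA w in auto)
  also have "\<dots> = c * max (\<integral>x. w x * L x \<partial>M) 0"
    using w_nonneg by (simp add: mean max_mult_distrib_right)
  also have "\<dots> \<le> c * (\<integral>x. P x \<partial>M)"
  proof (rule mult_left_mono[OF _ c], rule max.boundedI)
    show "(\<integral>x. w x * L x \<partial>M) \<le> (\<integral>x. P x \<partial>M)"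
      using wL P by (rule integral_mono) (simp add: P_eq)
    show "0 \<le> (\<integral>x. P x \<partial>M)"
      by (rule Bochner_Integration.integral_nonneg) (simp add: P_eq)
  qed
  finally show ?thesis
    by (simp add: P_def algebra_simps)
qed

theorem lemma3p6:
  fixes M :: "'a measure" and p U\<^sub>0 c :: real
    and f :: "'a \<Rightarrow> 'b::real_normed_field" and A :: "'a set"
  assumes "prob_space M"
    and "f \<in> borel_measurable M"
    and "p \<le> 0 \<Longrightarrow> AE x in M. f x \<noteq> 0"
    and "integrable M (\<lambda>x. norm (f x) powr p)"
    and "0 < (\<integral>x. norm (f x) powr p \<partial>M)"
    and "integrable M (\<lambda>x. norm (f x) powr p * ln (norm (f x)))"
    and "0 < U\<^sub>0" and "0 < c" and "c < 1"
    and "A = {x \<in> space M. norm (f x) \<ge> U\<^sub>0 powr (1 - c) * active_threshold M p f powr c}"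
  shows "(1 - c) * (\<integral>x. norm (f x) powr p * ln_plus (norm (f x) / U\<^sub>0) \<partial>M)
       \<le> (\<integral>x. norm (f x) powr p * ln_plus (norm (f x) / U\<^sub>0) * indicator A x \<partial>M)"
proof -
  define w where "w x = norm (f x) powr p" for x
  define L where "L x = ln (norm (f x) / U\<^sub>0)" for x
  define m where "m = ln (active_threshold M p f / U\<^sub>0)"
  note [measurable] = assms(2)
  \<comment> \<open>Where \<open>f\<close> vanishes, the logarithm does not split, but both sides are \<open>0\<close> because
    \<open>0 powr p = 0\<close> for every \<open>p\<close>.\<close>
  have wL_eq: "w x * L x = w x * ln (norm (f x)) - ln U\<^sub>0 * w x" for x
    using assms(7) by (cases "f x = 0") (auto simp: w_def L_def ln_div algebra_simps)
  have w: "integrable M w"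
    using assms(4) by (simp add: w_def[abs_def])
  have wln: "integrable M (\<lambda>x. w x * ln (norm (f x)))"
    using assms(6) by (simp add: w_def)
  have m_eq: "m = (\<integral>x. w x * ln (norm (f x)) \<partial>M) / (\<integral>x. w x \<partial>M) - ln U\<^sub>0"
    using assms(7) by (simp add: m_def active_threshold_def ln_div w_def)
  have main: "(1 - c) * (\<integral>x. w x * max (L x) 0 \<partial>M)
      \<le> (\<integral>x. w x * max (L x) 0 * indicator A x \<partial>M)"
  proof (rule positive_part_above_fraction_of_mean[where m = m])
    show "integrable M (\<lambda>x. w x * L x)"
      unfolding wL_eq using w wln by simp
    show "(\<integral>x. w x * L x \<partial>M) = m * (\<integral>x. w x \<partial>M)"
      unfolding wL_eq m_eq using w wln assms(5) by (simp add: w_def[abs_def] field_simps)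
    show "A \<in> sets M"
      unfolding assms(10) by measurable
  next
    fix x assume "x \<in> space M" "x \<notin> A" "w x \<noteq> 0"
    then have lt: "norm (f x) < U\<^sub>0 powr (1 - c) * active_threshold M p f powr c"
      and pos: "0 < norm (f x)"
      by (auto simp: assms(10) w_def)
    have "0 < active_threshold M p f"
      by (simp add: active_threshold_def)
    then have "ln (U\<^sub>0 powr (1 - c) * active_threshold M p f powr c) = ln U\<^sub>0 + c * m"
      using assms(7) by (simp add: m_def ln_mult ln_div ln_powr algebra_simps)
    moreover have "ln (norm (f x)) < ln (U\<^sub>0 powr (1 - c) * active_threshold M p f powr c)"
      using lt pos by (meson ln_less_cancel_iff less_trans)
    ultimately show "L x \<le> c * m"
      using pos assms(7) by (simp add: L_def ln_div)
  qed (use w assms(8) in \<open>auto simp: w_def[abs_def]\<close>)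
  have "ln_plus (norm (f x) / U\<^sub>0) = max (L x) 0" for x
    by (simp add: ln_plus_def L_def)
  then show ?thesis
    using main by (simp add: w_def)
qed

end
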